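(* Let $m\in\mathbb{N}$, let $\alpha_j,\beta_j,\gamma,b,c\in\mathbb{C}$ $(j=1,\dots,m)$ and let $\kappa>0$ be real, with $\sum_{j=1}^m\Re(\alpha_j)>\max\{0,\kappa-1\}$, $\Re(\beta_j)>0$ for all $j$, and $\Re(\gamma)>0$. Let $\xi,\sigma\in\mathbb{C}$ with $\Re(\xi+\sigma)>0$ and $\Re(\xi)>0$, and let $y\in\mathbb{C}$. Then $$\int_0^1 x^{\xi-1}(1-x)^{2(\xi+\sigma)-1}\left(1-\frac{x}{3}\right)^{2\xi-1}\left(1-\frac{x}{4}\right)^{(\xi+\sigma)-1}\mathcal{J}_{(\beta_j)_m,\kappa,b}^{(\alpha_j)_m,\gamma,c}\left(yx\left(1-\frac{x}{3}\right)^2\right)dx$$ $$=\frac{\Gamma(\xi+\sigma)}{\Gamma(\gamma)}\left(\frac23\right)^{2\xi}{}_2\Psi_{m+1}\left[\begin{array}{c}(\gamma,\kappa),(\xi,1)\\ \left(\beta_j+\frac{b+1}{2},\alpha_j\right)_{j=1}^m,(2\xi+\sigma,1)\end{array}\Big|\;\frac{4cy}{9}\right].$$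
   Context: The generalized multiindex Bessel function is $$\mathcal{J}_{(\beta_j)_m,\kappa,b}^{(\alpha_j)_m,\gamma,c}[z]=\sum_{n=0}^\infty\frac{c^n(\gamma)_{\kappa n}}{\prod_{j=1}^m\Gamma\left(\alpha_jn+\beta_j+\frac{b+1}{2}\right)}\frac{z^n}{n!},\qquad (\gamma)_{\nu}=\frac{\Gamma(\gamma+\nu)}{\Gamma(\gamma)}.$$ The Fox–Wright function is given by the series $${}_p\Psi_q\left[\begin{array}{c}(a_1,A_1),\dots,(a_p,A_p)\\(b_1,B_1),\dots,(b_q,B_q)\end{array}\Big|\;z\right]=\sum_{n=0}^\infty\frac{\Gamma(a_1+A_1n)\cdots\Gamma(a_p+A_pn)}{\Gamma(b_1+B_1n)\cdots\Gamma(b_q+B_qn)}\frac{z^n}{n!},$$ where some of the $B_j$ may be complex (here $B_j=\alpha_j$). Throughout, $1/\Gamma$ is the entire reciprocal Gamma function, with value $0$ at the poles of $\Gamma$. The notation $\left(\beta_j+\frac{b+1}{2},\alpha_j\right)_{j=1}^m$ stands for the list of the $m$ pairs $\left(\beta_j+\frac{b+1}{2},\alpha_j\right)$. *)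

theory Defs
  imports "HOL-Analysis.Analysis"
begin

definition gen_pochhammer :: "complex \<Rightarrow> complex \<Rightarrow> complex" where
  "gen_pochhammer \<gamma> \<nu> = Gamma (\<gamma> + \<nu>) / Gamma \<gamma>"

text \<open>Denominator Gamma factors are written with the entire reciprocal Gamma function
  \<^const>\<open>rGamma\<close>, which vanishes at the poles of \<^const>\<open>Gamma\<close>. The parameters \<open>\<alpha> j\<close>,
  \<open>\<beta> j\<close> are only used for \<open>1 \<le> j \<le> m\<close>.\<close>

definition multiindex_bessel ::
  "nat \<Rightarrow> (nat \<Rightarrow> complex) \<Rightarrow> (nat \<Rightarrow> complex) \<Rightarrow> real \<Rightarrow> complex \<Rightarrow> complex \<Rightarrow> complex
    \<Rightarrow> complex \<Rightarrow> complex" where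
  "multiindex_bessel m \<alpha> \<beta> \<kappa> b \<gamma> c z =
    (\<Sum>n. c ^ n * gen_pochhammer \<gamma> (of_real \<kappa> * of_nat n)
          * (\<Prod>j=1..m. rGamma (\<alpha> j * of_nat n + \<beta> j + (b + 1) / 2))
          * (z ^ n / fact n))"

text \<open>The two lists hold the upper pairs \<open>(a\<^sub>i, A\<^sub>i)\<close> and the lower pairs \<open>(b\<^sub>j, B\<^sub>j)\<close>.\<close>

definition fox_wright ::
  "(complex \<times> complex) list \<Rightarrow> (complex \<times> complex) list \<Rightarrow> complex \<Rightarrow> complex" where
  "fox_wright as bs z =
    (\<Sum>n. (\<Prod>(a, A)\<leftarrow>as. Gamma (a + A * of_nat n))
          * (\<Prod>(b, B)\<leftarrow>bs. rGamma (b + B * of_nat n))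
          * (z ^ n / fact n))"

end

theory Submission imports Defs begin

text \<open>Under \<open>u = 9/4 x (1 - x/3)\<^sup>2\<close> one has \<open>1 - u = (1 - x)\<^sup>2 (1 - x/4)\<close> and
  \<open>du = 9/4 (1 - x/3) (1 - x) dx\<close>, so the weight integrates to the Beta integral
  \<open>(2/3)\<^bsup>2\<xi>\<^esup> B(\<xi>, \<xi> + \<sigma>)\<close>. The \<open>n\<close>-th power of the argument of the Bessel
  function merely shifts \<open>\<xi>\<close> to \<open>\<xi> + n\<close>, so integrating termwise gives the Fox--Wright series.
  Termwise integration is dominated, since \<open>0 \<le> x (1 - x/3)\<^sup>2 \<le> 1\<close>, once the Bessel series converges
  absolutely; its \<open>n\<close>-th coefficient is at most \<open>K\<^sup>n n\<^bsup>p n\<^esup>\<close> with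
  \<open>p = \<kappa> - 1 - (\<Sum>j=1..m. Re (\<alpha> j)) < 0\<close>.\<close>

section \<open>The complex Beta integral and the Lavoie--Trottier integral\<close>

text \<open>A Borel version of the complex power, with \<open>t \<le> 0\<close> sent to \<open>0\<close>: products such as
  \<open>cpow a t * cpow b (u - t)\<close> then carry their own support and need no indicator functions.\<close>

definition cpow :: "complex \<Rightarrow> real \<Rightarrow> complex" where
  "cpow z t = (if t > 0 then exp (z * of_real (ln t)) else 0)"

lemma cpow_nonpos [simp]: "t \<le> 0 \<Longrightarrow> cpow z t = 0"
  by (simp add: cpow_def)

lemma cpow_eq_powr: "t \<ge> 0 \<Longrightarrow> cpow z t = of_real t powr z"
  by (auto simp: cpow_def powr_def Ln_of_real)

lemma cpow_mult: "s > 0 \<Longrightarrow> cpow z (s * t) = cpow z s * cpow z t"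
  by (auto simp: cpow_def ln_mult exp_add [symmetric] algebra_simps zero_less_mult_iff)

lemma cpow_add: "cpow (v + w) t = cpow v t * cpow w t"
  by (simp add: cpow_def exp_add [symmetric] algebra_simps)

lemma cpow_1: "t > 0 \<Longrightarrow> cpow 1 t = of_real t"
  by (simp add: cpow_def exp_of_real)

lemma norm_cpow: "t \<ge> 0 \<Longrightarrow> norm (cpow z t) = t powr Re z"
  by (auto simp: cpow_def powr_def)

lemma borel_measurable_cpow [measurable]: "cpow z \<in> borel_measurable borel"
  unfolding cpow_def by measurable

text \<open>Euler's integral moved from the Henstock-Kurzweil setting to a Bochner integral over
  \<open>lborel\<close>, where Fubini and translation invariance apply.\<close>

lemma has_bochner_integral_Gamma:
  assumes "Re z > 0"
  shows "has_bochner_integral lborel (\<lambda>t. cpow (z - 1) t * of_real (exp (- t))) (Gamma z)"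
proof -
  let ?f = "\<lambda>t. cpow (z - 1) t * of_real (exp (- t))"
  have "(\<lambda>t. complex_of_real t powr (z - 1) / of_real (exp t)) absolutely_integrable_on {0<..}"
    by (rule absolutely_integrable_Gamma_integral' [OF assms])
  hence "integrable lebesgue (\<lambda>t. indicator {0<..} t *\<^sub>R (complex_of_real t powr (z - 1) / of_real (exp t)))"
    by (simp add: set_integrable_def)
  also have "(\<lambda>t. indicator {0<..} t *\<^sub>R (complex_of_real t powr (z - 1) / of_real (exp t))) = ?f"
    by (auto simp: fun_eq_iff indicator_def cpow_eq_powr exp_minus field_simps exp_of_real)
  finally have int: "integrable lborel ?f"
    by (subst (asm) integrable_completion) auto
  have "((\<lambda>t. complex_of_real t powr (z - 1) / of_real (exp t)) has_integral Gamma z) {0<..}"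
    by (rule Gamma_integral_complex' [OF assms])
  hence "(?f has_integral Gamma z) {0<..}"
    by (rule has_integral_eq [rotated]) (auto simp: cpow_eq_powr exp_minus field_simps exp_of_real)
  hence "(?f has_integral Gamma z) UNIV"
    by (rule has_integral_on_superset) auto
  with has_integral_integral_lborel [OF int] have "integral\<^sup>L lborel ?f = Gamma z"
    using has_integral_unique by blast
  with int show ?thesis by (simp add: has_bochner_integral_iff)
qed

text \<open>On the unit interval the norm of the integrand is exactly the real Beta integrand at
  \<open>Re a\<close> and \<open>Re b\<close>; outside it everything vanishes.\<close>

lemma integrable_Beta_complex:
  assumes "Re a > 0" "Re b > 0"
  shows "integrable lborel (\<lambda>t. cpow (a - 1) t * cpow (b - 1) (1 - t))"
proof (rule Bochner_Integration.integrable_bound)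
  show "integrable lborel (\<lambda>t. indicator {0..1} t *\<^sub>R (t powr (Re a - 1) * (1 - t) powr (Re b - 1)))"
    using integrable_Beta [of "Re a" "Re b"] assms by (simp add: set_integrable_def)
  show "AE t in lborel. norm (cpow (a - 1) t * cpow (b - 1) (1 - t))
      \<le> norm (indicator {0..1} t *\<^sub>R (t powr (Re a - 1) * (1 - t) powr (Re b - 1)))"
  proof (intro AE_I2)
    fix t :: real
    show "norm (cpow (a - 1) t * cpow (b - 1) (1 - t))
      \<le> norm (indicator {0..1} t *\<^sub>R (t powr (Re a - 1) * (1 - t) powr (Re b - 1)))"
      by (cases "t \<in> {0..1}") (auto simp: norm_mult norm_cpow abs_mult)
  qed
qed measurable

text \<open>Classical convolution argument: the convolution of the Gamma integrands for
  \<open>a\<close> and \<open>b\<close> is the Gamma integrand for \<open>a + b\<close> times the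
  Beta integral, and integrating it in the other order gives
  \<open>Gamma a * Gamma b\<close>.\<close>

lemma has_bochner_integral_Beta_complex:
  assumes a: "Re a > 0" and b: "Re b > 0"
  shows "has_bochner_integral lborel (\<lambda>t. cpow (a - 1) t * cpow (b - 1) (1 - t)) (Beta a b)"
proof -
  define f where "f = (\<lambda>z t. cpow (z - 1) t * of_real (exp (- t)) :: complex)"
  have f_meas [measurable]: "f z \<in> borel_measurable borel" for z
    unfolding f_def by measurable
  have f_int: "integrable lborel (f z)" "integral\<^sup>L lborel (f z) = Gamma z" if "Re z > 0" for z
    using has_bochner_integral_Gamma [OF that] by (auto simp: f_def has_bochner_integral_iff)
  define B where "B = (\<integral>t. cpow (a - 1) t * cpow (b - 1) (1 - t) \<partial>lborel)"
  \<comment> \<open>Since \<open>cpow\<close> vanishes on nonpositive arguments,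
    \<open>?G t u\<close> lives on \<open>0 < t < u\<close> without any indicator.\<close>
  let ?G = "\<lambda>t u. f a t * f b (u - t)"
  have shift: "integrable lborel (\<lambda>u. h (u - t))"
    "(\<integral>u. h (u - t) \<partial>lborel) = (\<integral>u. h u \<partial>lborel)"
    if "integrable lborel h" for h :: "real \<Rightarrow> 'e::{banach, second_countable_topology}" and t
    using lborel_integrable_real_affine [OF that, of 1 "-t"]
      lborel_integral_real_affine [of 1 h "-t"] by simp_all
  \<comment> \<open>By translation invariance the inner integral of the norm is
    \<open>norm (f a t)\<close> times a constant, which is integrable in \<open>t\<close>.\<close>
  have G_int: "integrable (lborel \<Otimes>\<^sub>M lborel) (case_prod ?G)"
  proof (rule lborel_pair.Fubini_integrable)
    show "integrable lborel (\<lambda>t. \<integral>u. norm (case (t, u) of (t, u) \<Rightarrow> ?G t u) \<partial>lborel)"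
      using f_int(1) [OF a] shift [of "\<lambda>x. norm (f b x)"] f_int(1) [OF b]
      by (simp add: norm_mult)
    show "AE t in lborel. integrable lborel (\<lambda>u. case (t, u) of (t, u) \<Rightarrow> ?G t u)"
      using shift(1) [OF f_int(1) [OF b]] by simp
  qed (auto simp: case_prod_unfold cong: measurable_cong_sets)
  \<comment> \<open>The scaling \<open>t = u * s\<close> separates the powers of \<open>u\<close>
    from the Beta integrand in \<open>s\<close>; the Jacobian supplies the factor
    \<open>cpow 1 u\<close>.\<close>
  have inner: "(\<integral>t. ?G t u \<partial>lborel) = f (a + b) u * B" for u
  proof (cases "u > 0")
    case True
    have "(\<integral>t. ?G t u \<partial>lborel) = \<bar>u\<bar> *\<^sub>R (\<integral>s. ?G (0 + u * s) u \<partial>lborel)"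
      using True by (intro lborel_integral_real_affine) auto
    also have "(\<lambda>s. ?G (0 + u * s) u) =
        (\<lambda>s. (cpow (a - 1) u * cpow (b - 1) u * of_real (exp (- u))) *
              (cpow (a - 1) s * cpow (b - 1) (1 - s)))"
    proof
      fix s
      have "cpow (b - 1) (u - u * s) = cpow (b - 1) u * cpow (b - 1) (1 - s)"
        using cpow_mult [OF True, of "b - 1" "1 - s"] by (simp add: algebra_simps)
      moreover have "exp (- u) = exp (- (u * s)) * exp (u * s - u)"
        by (simp flip: exp_add)
      ultimately show "?G (0 + u * s) u = (cpow (a - 1) u * cpow (b - 1) u * of_real (exp (- u))) *
              (cpow (a - 1) s * cpow (b - 1) (1 - s))"
        by (simp add: f_def cpow_mult [OF True] del: of_real_exp)
    qed
    also have "\<bar>u\<bar> *\<^sub>R (\<integral>s. (cpow (a - 1) u * cpow (b - 1) u * of_real (exp (- u))) *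
              (cpow (a - 1) s * cpow (b - 1) (1 - s)) \<partial>lborel) =
          cpow 1 u * cpow (a - 1) u * cpow (b - 1) u * of_real (exp (- u)) * B"
      using True by (simp add: B_def cpow_1 scaleR_conv_of_real)
    also have "cpow 1 u * cpow (a - 1) u * cpow (b - 1) u = cpow (1 + (a - 1) + (b - 1)) u"
      by (simp only: cpow_add)
    also have "1 + (a - 1) + (b - 1) = a + b - 1" by simp
    finally show ?thesis by (simp add: f_def)
  next
    case False
    hence G0: "(\<lambda>t. ?G t u) = (\<lambda>t. 0)"
      by (auto simp: fun_eq_iff f_def cpow_def)
    show ?thesis using False unfolding G0 by (simp add: f_def)
  qed
  have "Gamma a * Gamma b = (\<integral>t. \<integral>u. ?G t u \<partial>lborel \<partial>lborel)"
    using f_int a b shift(2) [OF f_int(1) [OF b]] by simp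
  also have "\<dots> = (\<integral>u. \<integral>t. ?G t u \<partial>lborel \<partial>lborel)"
    by (rule lborel_pair.Fubini_integral [symmetric]) (rule G_int)
  also have "\<dots> = Gamma (a + b) * B"
    using f_int [of "a + b"] a b by (simp add: inner)
  finally have "Gamma (a + b) * B = Gamma a * Gamma b" ..
  \<comment> \<open>\<open>Gamma\<close> takes the value 0 at its poles, so dividing by
    \<open>Gamma (a + b)\<close> requires that \<open>a + b\<close> is not a pole.\<close>
  moreover have "a + b \<notin> \<int>\<^sub>\<le>\<^sub>0"
  proof
    assume "a + b \<in> \<int>\<^sub>\<le>\<^sub>0"
    then obtain n where "a + b = of_int n" "n \<le> 0" by (elim nonpos_Ints_cases)
    hence "Re a + Re b = of_int n" by (metis plus_complex.simps(1) complex_Re_of_int)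
    with \<open>n \<le> 0\<close> a b show False by (simp flip: of_int_0_le_iff add: not_le)
  qed
  ultimately have "B = Beta a b"
    by (simp add: Beta_def field_simps Gamma_eq_zero_iff)
  thus ?thesis
    using integrable_Beta_complex [OF a b] by (simp add: has_bochner_integral_iff B_def)
qed

text \<open>The form demanded by the change of variables theorem, on the open interval that the
  substitution maps onto itself.\<close>

lemma Beta_complex_absolutely_integrable_integral:
  assumes "Re a > 0" "Re b > 0"
  defines "f \<equiv> \<lambda>t. cpow (a - 1) t * cpow (b - 1) (1 - t)"
  shows "f absolutely_integrable_on {0<..<1}" "integral {0<..<1} f = Beta a b"
proof -
  have int: "integrable lborel f" and eq: "integral\<^sup>L lborel f = Beta a b"
    using has_bochner_integral_Beta_complex [OF assms(1,2)]
    by (auto simp: f_def has_bochner_integral_iff)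
  have 0: "f t = 0" if "t \<notin> {0<..<1}" for t
    using that by (cases "t > 0") (auto simp: f_def)
  have ind: "(\<lambda>t. indicator {0<..<1} t *\<^sub>R f t) = f"
    using 0 by (auto simp: fun_eq_iff indicator_def)
  show "f absolutely_integrable_on {0<..<1}"
    unfolding set_integrable_def ind
    using int by (subst integrable_completion) (auto simp: f_def)
  have "(\<lambda>t. if t \<in> {0<..<1} then f t else 0) = f"
    using 0 by auto
  moreover have "(f has_integral Beta a b) UNIV"
    using has_integral_integral_lborel [OF int] eq by simp
  ultimately have "(f has_integral Beta a b) {0<..<1}"
    by (subst has_integral_restrict_UNIV [symmetric]) simp
  thus "integral {0<..<1} f = Beta a b" by (rule integral_unique)
qed

text \<open>Pulling the Beta integrand back along \<open>g\<close> produces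
  \<open>(9 / 4) powr a * w\<close>; the constant is then moved to the other side and the two
  endpoints are added as a null set.\<close>

lemma Lavoie_Trottier:
  assumes a: "Re a > 0" and b: "Re b > 0"
  defines "w \<equiv> \<lambda>x::real. of_real x powr (a - 1) * of_real (1 - x) powr (2 * b - 1)
              * of_real (1 - x / 3) powr (2 * a - 1) * of_real (1 - x / 4) powr (b - 1)"
  shows "w absolutely_integrable_on {0..1}"
    and "(w has_integral ((2 / 3) powr (2 * a) * Beta a b)) {0..1}"
proof -
  define g :: "real \<Rightarrow> real" where "g = (\<lambda>x. 9 / 4 * x * (1 - x / 3) ^ 2)"
  define h :: "real \<Rightarrow> real" where "h = (\<lambda>x. 9 / 4 * (1 - x / 3) * (1 - x))"
  define f where "f = (\<lambda>t. cpow (a - 1) t * cpow (b - 1) (1 - t))"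
  \<comment> \<open>Both product forms nest to the right because \<open>cpow_mult\<close> splits off
    a positive left factor at a time.\<close>
  have g_alt': "g x = 9 / 4 * (x * ((1 - x / 3) * (1 - x / 3)))" for x
    by (simp add: g_def power2_eq_square)
  have g_alt: "1 - g x = (1 - x) * ((1 - x) * (1 - x / 4))" for x
    unfolding g_def by (simp add: power2_eq_square field_simps)
  have deriv: "(g has_field_derivative h x) (at x within S)" for x S
    unfolding g_def h_def
    by (auto intro!: derivative_eq_intros simp: power2_eq_square field_simps)
  \<comment> \<open>The derivative \<open>h\<close> vanishes at 1, so strictness up to that endpoint
    rests on positivity in the open interval only.\<close>
  have mono: "g x < g y" if "0 \<le> x" "x < y" "y \<le> 1" for x y
  proof (rule DERIV_pos_imp_increasing_open [OF \<open>x < y\<close>])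
    fix t assume "x < t" "t < y"
    with that have "h t > 0" by (auto simp: h_def intro!: mult_pos_pos)
    thus "\<exists>D. (g has_real_derivative D) (at t) \<and> 0 < D" using deriv by blast
  qed (auto intro!: continuous_intros simp: g_def)
  have inj: "inj_on g {0<..<1}"
    proof (rule linorder_inj_onI)
    show "g x \<noteq> g y" if "x < y" "x \<in> {0<..<1}" "y \<in> {0<..<1}" for x y
      using mono [of x y] that by auto
  qed auto
  have g01: "g 0 = 0" "g 1 = 1" by (auto simp: g_def power2_eq_square)
  have image: "g ` {0<..<1} = {0<..<1}"
  proof (intro equalityI subsetI)
    fix u assume "u \<in> g ` {0<..<1}"
    thus "u \<in> {0<..<1}" using mono [of 0] mono [of _ 1] g01 by auto
  next
    fix u :: real assume u: "u \<in> {0<..<1}"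
    have "\<exists>x\<ge>0. x \<le> 1 \<and> g x = u"
      using u g01 by (intro IVT') (auto intro!: continuous_intros simp: g_def)
    then obtain x where "0 \<le> x" "x \<le> 1" "g x = u" by blast
    moreover from this have "x \<noteq> 0" "x \<noteq> 1" using u g01 by auto
    ultimately show "u \<in> g ` {0<..<1}" by (auto intro!: image_eqI [of _ _ x])
  qed
  have fg: "\<bar>h x\<bar> *\<^sub>R f (g x) = (9 / 4) powr a * w x" if x: "x \<in> {0<..<1}" for x
  proof -
    have "cpow (a - 1) (g x) = cpow (a - 1) (9 / 4) * (cpow (a - 1) x *
            (cpow (a - 1) (1 - x / 3) * cpow (a - 1) (1 - x / 3)))"
      using x by (simp add: g_alt' cpow_mult del: times_divide_eq_left times_divide_eq_right)
    moreover have "cpow (b - 1) (1 - g x) = cpow (b - 1) (1 - x) *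
            (cpow (b - 1) (1 - x) * cpow (b - 1) (1 - x / 4))"
      unfolding g_alt using x by (simp add: cpow_mult)
    moreover have "complex_of_real \<bar>h x\<bar> = cpow 1 (9 / 4) * cpow 1 (1 - x / 3) * cpow 1 (1 - x)"
      using x by (simp add: cpow_1 h_def)
    \<comment> \<open>Collecting exponents by base: \<open>1 + (a - 1)\<close> on 9/4,
      \<open>1 + 2 * (b - 1)\<close> on \<open>1 - x\<close>, and \<open>1 + 2 * (a - 1)\<close> on
      \<open>1 - x / 3\<close>, where each 1 comes from the Jacobian.\<close>
    ultimately have "\<bar>h x\<bar> *\<^sub>R f (g x) = (cpow 1 (9 / 4) * cpow (a - 1) (9 / 4)) * cpow (a - 1) x
          * (cpow 1 (1 - x) * cpow (b - 1) (1 - x) * cpow (b - 1) (1 - x))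
          * (cpow 1 (1 - x / 3) * cpow (a - 1) (1 - x / 3) * cpow (a - 1) (1 - x / 3))
          * cpow (b - 1) (1 - x / 4)"
      unfolding f_def scaleR_conv_of_real by (simp add: mult_ac)
    also have "\<dots> = cpow a (9 / 4) * cpow (a - 1) x * cpow (2 * b - 1) (1 - x)
          * cpow (2 * a - 1) (1 - x / 3) * cpow (b - 1) (1 - x / 4)"
      by (simp only: cpow_add [symmetric]) simp
    also have "\<dots> = (9 / 4) powr a * w x"
      using x by (simp add: cpow_eq_powr w_def mult.assoc)
    finally show ?thesis .
  qed
  have "(\<lambda>x. \<bar>h x\<bar> *\<^sub>R f (g x)) absolutely_integrable_on {0<..<1} \<and>
        integral {0<..<1} (\<lambda>x. \<bar>h x\<bar> *\<^sub>R f (g x)) = Beta a b"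
    using Beta_complex_absolutely_integrable_integral [OF a b]
    by (subst has_absolute_integral_change_of_variables_real) (auto intro: deriv inj simp: image f_def)
  hence 1: "(\<lambda>x. (9 / 4) powr a * w x) absolutely_integrable_on {0<..<1}"
    and 2: "integral {0<..<1} (\<lambda>x. (9 / 4) powr a * w x) = Beta a b"
    using fg set_integrable_cong [of lebesgue lebesgue "{0<..<1}" "{0<..<1}"
        "\<lambda>x. \<bar>h x\<bar> *\<^sub>R f (g x)" "\<lambda>x. (9 / 4) powr a * w x"]
      Henstock_Kurzweil_Integration.integral_cong [of "{0<..<1}"
        "\<lambda>x. \<bar>h x\<bar> *\<^sub>R f (g x)" "\<lambda>x. (9 / 4) powr a * w x"] by auto
  \<comment> \<open>The constants are handled through \<open>cpow\<close>, whose product rule needs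
    no care about branches for positive bases.\<close>
  have c: "(4 / 9) powr a * (9 / 4) powr a = (1 :: complex)"
  proof -
    have "cpow a (4 / 9) * cpow a (9 / 4) = cpow a 1"
      by (subst cpow_mult [symmetric]) auto
    thus ?thesis by (simp add: cpow_eq_powr)
  qed
  have c': "(4 / 9) powr a = (2 / 3 :: complex) powr (2 * a)"
  proof -
    have "cpow a (2 / 3 * (2 / 3)) = cpow (a + a) (2 / 3)"
      by (simp only: cpow_add) (rule cpow_mult, simp)
    also have "a + a = 2 * a" by simp
    finally show ?thesis by (simp add: cpow_eq_powr)
  qed
  have "(\<lambda>x. (4 / 9) powr a * ((9 / 4) powr a * w x)) absolutely_integrable_on {0<..<1}"
    using 1 by (rule set_integrable_mult_right)
  hence "w absolutely_integrable_on {0<..<1}"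
    by (simp only: mult.assoc [symmetric] c mult_1_left)
  thus "w absolutely_integrable_on {0..1}"
    by (rule absolutely_integrable_spike_set) (auto intro: negligible_subset [of "{0, 1}"])
  have "((\<lambda>x. (9 / 4) powr a * w x) has_integral Beta a b) {0<..<1}"
    using 1 2 by (metis has_integral_iff set_lebesgue_integral_eq_integral(1))
  hence "((\<lambda>x. (4 / 9) powr a * ((9 / 4) powr a * w x)) has_integral ((4 / 9) powr a * Beta a b)) {0<..<1}"
    by (rule has_integral_mult_right)
  hence "(w has_integral ((4 / 9) powr a * Beta a b)) {0<..<1}"
    by (simp only: mult.assoc [symmetric] c mult_1_left)
  thus "(w has_integral ((2 / 3) powr (2 * a) * Beta a b)) {0..1}"
    by (simp add: has_integral_Icc_iff_Ioo c')
qed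

section \<open>Growth of the Gamma function along arithmetic progressions\<close>

text \<open>With \<open>x = Re z + n\<close> and \<open>y = Im z\<close>, the upper bound follows
  from \<open>1 + s \<le> exp s\<close> at \<open>s = y^2 / x^2\<close> and from
  \<open>1 / x^2 \<le> 2 * (1 / x - 1 / (x + 1))\<close>, which needs \<open>x \<ge> 1\<close>. The
  difference of reciprocals is chosen so that products over \<open>n\<close> telescope.\<close>

lemma norm_add_of_nat_bounds:
  fixes z :: complex
  assumes "Re z > 0"
  shows "Re z + real n \<le> norm (z + of_nat n)"
    and "Re z \<ge> 1 \<Longrightarrow> norm (z + of_nat n) \<le>
      (Re z + real n) * exp ((Im z)\<^sup>2 * (1 / (Re z + real n) - 1 / (Re z + real n + 1)))"
proof -
  define x y where "x = Re z + real n" and "y = Im z"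
  have eq: "(norm (z + of_nat n))\<^sup>2 = x\<^sup>2 + y\<^sup>2"
    by (simp add: cmod_power2 x_def y_def)
  have x: "x > 0" using assms by (simp add: x_def)
  show "Re z + real n \<le> norm (z + of_nat n)"
    using complex_Re_le_cmod [of "z + of_nat n"] by simp
  assume "Re z \<ge> 1"
  hence x1: "x \<ge> 1" by (simp add: x_def)
  have "1 / x\<^sup>2 \<le> 2 * (1 / x - 1 / (x + 1))"
  proof -
    have "1 / (x * x) \<le> 2 / (x * (x + 1))"
      using x1 mult_left_mono [of 1 x x] by (simp add: divide_le_eq)
    also have "2 / (x * (x + 1)) = 2 * (1 / x - 1 / (x + 1))"
      using x1 by (simp add: divide_simps)
    finally show ?thesis by (simp add: power2_eq_square)
  qed
  hence "y\<^sup>2 * (1 / x\<^sup>2) \<le> y\<^sup>2 * (2 * (1 / x - 1 / (x + 1)))"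
    by (rule mult_left_mono) simp
  have "x\<^sup>2 + y\<^sup>2 = x\<^sup>2 * (1 + y\<^sup>2 * (1 / x\<^sup>2))" using x by (simp add: field_simps)
  also have "\<dots> \<le> x\<^sup>2 * exp (y\<^sup>2 * (1 / x\<^sup>2))"
    by (intro mult_left_mono exp_ge_add_one_self) simp
  also have "\<dots> \<le> x\<^sup>2 * exp (y\<^sup>2 * (2 * (1 / x - 1 / (x + 1))))"
    by (intro mult_left_mono) (simp_all only: exp_le_cancel_iff \<open>y\<^sup>2 * (1 / x\<^sup>2) \<le> _\<close> zero_le_power2)
  also have "\<dots> = (x * exp (y\<^sup>2 * (1 / x - 1 / (x + 1))))\<^sup>2"
    by (simp add: power_mult_distrib flip: exp_double)
  finally have "norm (z + of_nat n) \<le> x * exp (y\<^sup>2 * (1 / x - 1 / (x + 1)))"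
    unfolding eq [symmetric] by (rule power2_le_imp_le) (use x in simp)
  thus "norm (z + of_nat n) \<le>
      (Re z + real n) * exp ((Im z)\<^sup>2 * (1 / (Re z + real n) - 1 / (Re z + real n + 1)))"
    by (simp add: x_def y_def)
qed

lemma norm_pochhammer_ge:
  fixes z :: complex
  assumes "Re z > 0"
  shows "pochhammer (Re z) n \<le> norm (pochhammer z n)"
proof (induction n)
  case (Suc n)
  have "pochhammer (Re z) n * (Re z + real n) \<le> norm (pochhammer z n) * norm (z + of_nat n)"
    using Suc assms norm_add_of_nat_bounds(1) [OF assms, of n]
    by (intro mult_mono) (auto intro: add_nonneg_nonneg)
  thus ?case by (simp add: pochhammer_Suc norm_mult)
qed simp

text \<open>The exponents telescope, so the loss against the real axis never exceeds
  \<open>exp ((Im z)^2 / Re z)\<close>, uniformly in \<open>n\<close>.\<close>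

lemma norm_pochhammer_le:
  fixes z :: complex
  assumes "Re z \<ge> 1"
  shows "norm (pochhammer z n) \<le>
    pochhammer (Re z) n * exp ((Im z)\<^sup>2 * (1 / Re z - 1 / (Re z + real n)))"
proof (induction n)
  case (Suc n)
  let ?e = "\<lambda>u v. exp ((Im z)\<^sup>2 * (1 / u - 1 / v))"
  have "norm (pochhammer z (Suc n)) = norm (pochhammer z n) * norm (z + of_nat n)"
    by (simp add: pochhammer_Suc norm_mult)
  also have "\<dots> \<le> (pochhammer (Re z) n * ?e (Re z) (Re z + real n)) *
      ((Re z + real n) * ?e (Re z + real n) (Re z + real n + 1))"
    using assms norm_add_of_nat_bounds(2) [of z n] Suc
    by (intro mult_mono) (auto intro!: mult_nonneg_nonneg pochhammer_nonneg)
  also have "\<dots> = pochhammer (Re z) (Suc n) *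
      (?e (Re z) (Re z + real n) * ?e (Re z + real n) (Re z + real n + 1))"
    by (simp only: pochhammer_Suc mult_ac)
  also have "?e (Re z) (Re z + real n) * ?e (Re z + real n) (Re z + real n + 1) =
      ?e (Re z) (Re z + real (Suc n))"
    by (simp add: algebra_simps flip: exp_add)
  finally show ?case .
qed simp

section \<open>From Pochhammer symbols to \<open>Gamma\<close> and \<open>rGamma\<close> by Euler's
  limit\<close>

lemma norm_rGamma_series:
  "norm (rGamma_series (z :: complex) n) =
    norm (pochhammer z (n + 1)) / (fact n * exp (Re z * ln (real n)))"
  by (simp add: rGamma_series_def norm_mult norm_divide)

text \<open>Each \<open>rGamma_series\<close> term at \<open>z\<close> dominates in norm the one at
  \<open>Re z\<close>; the limit keeps the inequality and inversion reverses it.\<close>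

lemma norm_Gamma_le:
  assumes "Re z > 0"
  shows "norm (Gamma z) \<le> Gamma (Re z)"
proof -
  have "rGamma (Re z) \<le> norm (rGamma z)"
  proof (rule LIMSEQ_le)
    show "rGamma_series (Re z) \<longlonglongrightarrow> rGamma (Re z)" by (rule rGamma_series_LIMSEQ)
    show "(\<lambda>n. norm (rGamma_series z n)) \<longlonglongrightarrow> norm (rGamma z)"
      by (intro tendsto_norm rGamma_series_LIMSEQ)
    show "\<exists>N. \<forall>n\<ge>N. rGamma_series (Re z) n \<le> norm (rGamma_series z n)"
      unfolding norm_rGamma_series using norm_pochhammer_ge [OF assms]
      by (auto simp: rGamma_series_def intro!: divide_right_mono)
  qed
  moreover have "rGamma (Re z) > 0" using assms by (simp add: rGamma_inverse_Gamma)
  ultimately have "inverse (norm (rGamma z)) \<le> inverse (rGamma (Re z))"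
    by (rule le_imp_inverse_le)
  thus ?thesis by (simp add: Gamma_def norm_inverse)
qed

text \<open>The reverse comparison costs an exponential factor. Along \<open>z = a * n + b\<close>
  with \<open>Re a > 0\<close> its exponent is only linear in \<open>n\<close>, hence harmless for
  the growth rate.\<close>

lemma norm_rGamma_le:
  assumes "Re z \<ge> 1"
  shows "norm (rGamma z) \<le> rGamma (Re z) * exp ((Im z)\<^sup>2 / Re z)"
proof (rule LIMSEQ_le)
  show "(\<lambda>n. rGamma_series (Re z) n * exp ((Im z)\<^sup>2 / Re z)) \<longlonglongrightarrow> rGamma (Re z) * exp ((Im z)\<^sup>2 / Re z)"
    by (intro tendsto_mult tendsto_const rGamma_series_LIMSEQ)
  show "(\<lambda>n. norm (rGamma_series z n)) \<longlonglongrightarrow> norm (rGamma z)"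
    by (intro tendsto_norm rGamma_series_LIMSEQ)
  have "norm (rGamma_series z n) \<le> rGamma_series (Re z) n * exp ((Im z)\<^sup>2 / Re z)" for n
  proof -
    have "(Im z)\<^sup>2 * (1 / Re z - 1 / (Re z + real (n + 1))) \<le> (Im z)\<^sup>2 * (1 / Re z)"
      using assms by (intro mult_left_mono) auto
    hence "pochhammer (Re z) (n + 1) * exp ((Im z)\<^sup>2 * (1 / Re z - 1 / (Re z + real (n + 1))))
        \<le> pochhammer (Re z) (n + 1) * exp ((Im z)\<^sup>2 / Re z)"
      using assms by (intro mult_left_mono pochhammer_nonneg) auto
    with norm_pochhammer_le [OF assms, of "n + 1"]
    have "norm (pochhammer z (n + 1)) \<le> pochhammer (Re z) (n + 1) * exp ((Im z)\<^sup>2 / Re z)"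
      by linarith
    hence "norm (pochhammer z (n + 1)) / (fact n * exp (Re z * ln (real n)))
        \<le> (pochhammer (Re z) (n + 1) * exp ((Im z)\<^sup>2 / Re z)) / (fact n * exp (Re z * ln (real n)))"
      by (rule divide_right_mono) simp
    thus ?thesis unfolding norm_rGamma_series by (simp add: rGamma_series_def)
  qed
  thus "\<exists>N. \<forall>n\<ge>N. norm (rGamma_series z n) \<le> rGamma_series (Re z) n * exp ((Im z)\<^sup>2 / Re z)"
    by blast
qed

text \<open>A crude Stirling estimate. Below: keep only \<open>t \<ge> x\<close> in Euler's integral
  and replace \<open>t powr x\<close> by \<open>x powr x\<close>. Above: split
  \<open>exp (- t)\<close> into two halves; \<open>t powr x * exp (- t / 2)\<close> peaks at
  \<open>t = 2 * x\<close>, and the other half integrates to 2.\<close>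

lemma Gamma_plus1_bounds:
  assumes x: "x > (0 :: real)"
  shows "exp (x * ln x - x) \<le> Gamma (x + 1)"
    and "Gamma (x + 1) \<le> 2 * exp (x * ln (2 * x) - x)"
proof -
  have G: "((\<lambda>t. t powr x / exp t) has_integral Gamma (x + 1)) {0..}"
    using Gamma_integral_real [of "x + 1"] x by simp
  have E: "((\<lambda>t. exp (x * ln x) * exp (- 1 * t)) has_integral exp (x * ln x) * (exp (- 1 * x) / 1)) {x..}"
    by (intro has_integral_mult_right has_integral_exp_minus_to_infinity) simp
  have "exp (x * ln x) * (exp (- 1 * x) / 1) \<le> Gamma (x + 1)"
  proof (rule has_integral_le [OF has_integral_on_superset])
    show "((\<lambda>t. if t \<in> {x..} then exp (x * ln x) * exp (- 1 * t) else 0)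
        has_integral exp (x * ln x) * (exp (- 1 * x) / 1)) {x..}"
      using E by (rule has_integral_eq [rotated]) simp
    show "(if t \<in> {x..} then exp (x * ln x) * exp (- 1 * t) else 0) \<le> t powr x / exp t"
      if "t \<in> {0..}" for t
      using x by (auto simp: powr_def exp_minus field_simps intro!: mult_left_mono)
  qed (use x G in auto)
  thus "exp (x * ln x - x) \<le> Gamma (x + 1)"
    by (simp add: exp_diff exp_minus field_simps)
  have "Gamma (x + 1) \<le> exp (x * ln (2 * x) - x) * (exp (- (1 / 2) * 0) / (1 / 2))"
  proof (rule has_integral_le [OF G])
    show "((\<lambda>t. exp (x * ln (2 * x) - x) * exp (- (1 / 2) * t)) has_integral
        exp (x * ln (2 * x) - x) * (exp (- (1 / 2) * 0) / (1 / 2))) {0..}"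
      by (intro has_integral_mult_right has_integral_exp_minus_to_infinity) simp
    fix t :: real assume "t \<in> {0..}"
    show "t powr x / exp t \<le> exp (x * ln (2 * x) - x) * exp (- (1 / 2) * t)"
    proof (cases "t = 0")
      case False
      hence t: "t > 0" using \<open>t \<in> {0..}\<close> by simp
      \<comment> \<open>The maximality at \<open>t = 2 * x\<close>, obtained from
        \<open>ln s \<le> s - 1\<close> at \<open>s = t / (2 * x)\<close>.\<close>
      have "ln (t / (2 * x)) \<le> t / (2 * x) - 1"
        using t x by (intro ln_le_minus_one) simp
      hence "x * ln (t / (2 * x)) \<le> x * (t / (2 * x) - 1)"
        using x by (intro mult_left_mono) auto
      also have "\<dots> = t / 2 - x" using x by (simp add: field_simps)
      finally have "x * ln t - t \<le> x * ln (2 * x) - x + - (1 / 2) * t"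
        using t x by (simp add: ln_div algebra_simps)
      hence "exp (x * ln t - t) \<le> exp (x * ln (2 * x) - x + - (1 / 2) * t)" by simp
      moreover have "t powr x / exp t = exp (x * ln t - t)"
        using t by (simp add: powr_def exp_diff)
      ultimately show ?thesis by (simp only: exp_add)
    qed auto
  qed
  thus "Gamma (x + 1) \<le> 2 * exp (x * ln (2 * x) - x)" by simp
qed

text \<open>That is, \<open>|f n| \<le> K\<^sup>n n\<^bsup>p n\<^esup>\<close> for some \<open>K\<close> and all \<open>n \<ge> 1\<close>.\<close>

definition power_growth :: "real \<Rightarrow> (nat \<Rightarrow> complex) \<Rightarrow> bool" where
  "power_growth p f \<longleftrightarrow>
    (\<exists>C. \<forall>n\<ge>1. norm (f n) \<le> exp (C * real n + p * (real n * ln (real n))))"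

lemma power_growthI:
  assumes "\<And>n. n \<ge> 1 \<Longrightarrow> norm (f n) \<le> exp (C * real n + p * (real n * ln (real n)))"
  shows "power_growth p f"
  using assms unfolding power_growth_def by blast

section \<open>Rules for growth exponents\<close>

lemma power_growth_mult:
  assumes "power_growth p f" "power_growth q g"
  shows "power_growth (p + q) (\<lambda>n. f n * g n)"
proof -
  obtain C D where
    C: "\<And>n. n \<ge> 1 \<Longrightarrow> norm (f n) \<le> exp (C * real n + p * (real n * ln (real n)))" and
    D: "\<And>n. n \<ge> 1 \<Longrightarrow> norm (g n) \<le> exp (D * real n + q * (real n * ln (real n)))"
    using assms unfolding power_growth_def by blast
  show ?thesis
  proof (rule power_growthI [where C = "C + D"])
    fix n :: nat assume "n \<ge> 1"
    hence "norm (f n * g n) \<le> exp (C * real n + p * (real n * ln (real n))) *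
        exp (D * real n + q * (real n * ln (real n)))"
      unfolding norm_mult using C D by (intro mult_mono) auto
    also have "\<dots> = exp ((C + D) * real n + (p + q) * (real n * ln (real n)))"
      by (simp add: algebra_simps flip: exp_add)
    finally show "norm (f n * g n) \<le> \<dots>" .
  qed
qed

lemma power_growth_const_power: "power_growth 0 (\<lambda>n. w ^ n)"
proof (rule power_growthI [where C = "norm w"])
  fix n :: nat
  have "norm w ^ n \<le> exp (norm w) ^ n"
  proof (rule power_mono)
    show "norm w \<le> exp (norm w)" using exp_ge_add_one_self [of "norm w"] by linarith
  qed simp
  thus "norm (w ^ n) \<le> exp (norm w * real n + 0 * (real n * ln (real n)))"
    by (simp add: norm_power mult.commute exp_of_nat_mult)
qed

text \<open>A constant fits under \<open>exp (C * n)\<close> because only \<open>n \<ge> 1\<close>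
  counts.\<close>

lemma power_growth_const: "power_growth 0 (\<lambda>n. w)"
proof (rule power_growthI [where C = "norm w"])
  fix n :: nat assume "n \<ge> 1"
  hence "norm w * 1 \<le> norm w * real n" by (intro mult_left_mono) auto
  hence "norm w \<le> exp (norm w * real n)"
    using exp_ge_add_one_self [of "norm w * real n"] by linarith
  thus "norm w \<le> exp (norm w * real n + 0 * (real n * ln (real n)))" by simp
qed

lemma power_growth_prod:
  assumes "finite A" "\<And>j. j \<in> A \<Longrightarrow> power_growth (p j) (f j)"
  shows "power_growth (\<Sum>j\<in>A. p j) (\<lambda>n. \<Prod>j\<in>A. f j n)"
  using assms
proof (induction rule: finite_induct)
  case empty
  show ?case using power_growth_const_power [of 1] by simp
qed (auto intro: power_growth_mult)

text \<open>For negative \<open>p\<close> the quantity \<open>C + p * ln n\<close> eventually drops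
  below -1, which gives a geometric majorant of ratio \<open>exp (-1)\<close>.\<close>

lemma power_growth_summable:
  assumes "power_growth p f" "p < 0"
  shows "summable (\<lambda>n. norm (f n))"
proof -
  obtain C where
    C: "\<And>n. n \<ge> 1 \<Longrightarrow> norm (f n) \<le> exp (C * real n + p * (real n * ln (real n)))"
    using assms unfolding power_growth_def by blast
  have "eventually (\<lambda>n. norm (norm (f n)) \<le> exp (-1) ^ n) sequentially"
    using eventually_ge_at_top [of "max 1 (nat \<lceil>exp ((C + 1) / - p)\<rceil>)"]
  proof eventually_elim
    case (elim n)
    hence n: "n \<ge> 1" and "real n \<ge> exp ((C + 1) / - p)" by linarith+
    hence "ln (real n) \<ge> (C + 1) / - p" by (subst ln_ge_iff) auto
    hence "C + p * ln (real n) \<le> -1" using \<open>p < 0\<close> by (simp add: field_simps)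
    hence "real n * (C + p * ln (real n)) \<le> real n * (-1)"
      by (rule mult_left_mono) simp
    hence "exp (C * real n + p * (real n * ln (real n))) \<le> exp (real n * (-1))"
      by (simp add: algebra_simps)
    also have "\<dots> = exp (-1) ^ n" by (rule exp_of_nat_mult)
    finally show ?case using C [OF n] by simp
  qed
  thus ?thesis
    by (rule summable_comparison_test_ev) (auto intro: summable_geometric)
qed

text \<open>Reduce to the real point \<open>u = Re z + s * n\<close>, which lies between
  \<open>x\<close> and \<open>M * n\<close>, and apply the Stirling-type upper bound there.\<close>

lemma power_growth_Gamma:
  assumes "Re z > 0" "s \<ge> 0"
  shows "power_growth s (\<lambda>n. Gamma (z + of_real s * of_nat n))"
proof -
  define x where "x = Re z"
  define M where "M = max 1 (x + s)"
  have x: "x > 0" using assms by (simp add: x_def)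
  show ?thesis
  \<comment> \<open>The three summands absorb the prefactor \<open>2 / u\<close>, the term
    \<open>u * ln (2 * M)\<close>, and the leftover \<open>x * ln n\<close> of
    \<open>u * ln n\<close>.\<close>
  proof (rule power_growthI [where C = "2 / x + M * ln (2 * M) + x"])
    fix n :: nat assume n: "n \<ge> 1"
    define u where "u = x + s * real n"
    have u: "u \<ge> x" "u > 0" "u \<le> M * real n"
    proof -
      show "u \<ge> x" "u > 0" using x assms by (auto simp: u_def add_pos_nonneg)
      have "x * 1 \<le> x * real n" using x n by (intro mult_left_mono) auto
      hence "u \<le> (x + s) * real n" unfolding u_def by (simp add: algebra_simps)
      also have "\<dots> \<le> M * real n" by (intro mult_right_mono) (auto simp: M_def)
      finally show "u \<le> M * real n" .
    qed
    have M: "M \<ge> 1" by (simp add: M_def)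
    have lnn: "0 \<le> ln (real n)" "ln (real n) \<le> real n"
      using n ln_bound [of "real n"] by auto
    have "Re (z + of_real s * of_nat n) = u" by (simp add: x_def u_def)
    hence "norm (Gamma (z + of_real s * of_nat n)) \<le> Gamma u"
      using norm_Gamma_le [of "z + of_real s * of_nat n"] u by simp
    also have "Gamma u = Gamma (u + 1) / u"
    proof -
      have "u \<notin> \<int>\<^sub>\<le>\<^sub>0" using u by (auto elim!: nonpos_Ints_cases)
      thus ?thesis using u by (simp add: Gamma_plus1)
    qed
    also have "\<dots> \<le> 2 * exp (u * ln (2 * u) - u) / u"
      using u by (intro divide_right_mono Gamma_plus1_bounds) auto
    also have "\<dots> \<le> (2 / x) * exp (u * ln (2 * u) - u)"
      using u x by (simp add: frac_le)
    also have "\<dots> \<le> exp (2 / x) * exp (u * ln (2 * u) - u)"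
    proof (rule mult_right_mono)
      show "2 / x \<le> exp (2 / x)" using exp_ge_add_one_self [of "2 / x"] by linarith
    qed simp
    also have "\<dots> = exp (2 / x + (u * ln (2 * u) - u))" by (simp only: exp_add)
    also have "\<dots> \<le> exp ((2 / x + M * ln (2 * M) + x) * real n + s * (real n * ln (real n)))"
    proof -
      have "2 / x * 1 \<le> 2 / x * real n" using x n by (intro mult_left_mono) auto
      moreover have "u * ln (2 * u) \<le> u * (ln (2 * M) + ln (real n))"
      proof (rule mult_left_mono)
        have "ln (2 * u) \<le> ln (2 * M * real n)" using u M n by (subst ln_le_cancel_iff) auto
        thus "ln (2 * u) \<le> ln (2 * M) + ln (real n)" using M n by (simp add: ln_mult)
      qed (use u in auto)
      moreover have "u * ln (2 * M) \<le> M * real n * ln (2 * M)"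
        using u M by (intro mult_right_mono) auto
      moreover have "x * ln (real n) \<le> x * real n"
        using x lnn by (intro mult_left_mono) auto
      ultimately have "2 / x + (u * ln (2 * u) - u) \<le>
          2 / x * real n + M * real n * ln (2 * M) + x * real n + s * real n * ln (real n)"
        using u by (simp add: u_def algebra_simps)
      thus ?thesis by (simp add: algebra_simps)
    qed
    finally show "norm (Gamma (z + of_real s * of_nat n)) \<le>
        exp ((2 / x + M * ln (2 * M) + x) * real n + s * (real n * ln (real n)))" .
  qed
qed

text \<open>The hypothesis forces \<open>Re z - 1 \<ge> n\<close> at \<open>z = a * n + b\<close>,
  so \<open>norm_rGamma_le\<close> applies and its correction \<open>(Im z)^2 / Re z\<close> is at
  most linear in \<open>n\<close>.\<close>

lemma power_growth_rGamma_right: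
  assumes "Re a \<ge> 2 + \<bar>Re b\<bar>"
  shows "power_growth (- Re a) (\<lambda>n. rGamma (a * of_nat n + b))"
proof -
  \<comment> \<open>In order: the linear bound for \<open>x\<close>, the remainder
    \<open>(1 - Re b) * ln n\<close>, and the correction for the imaginary part.\<close>
  define C where "C = Re a + \<bar>Re b\<bar> + \<bar>1 - Re b\<bar> + (\<bar>Im a\<bar> + \<bar>Im b\<bar>)\<^sup>2"
  show ?thesis
  proof (rule power_growthI [where C = C])
    fix n :: nat assume n: "n \<ge> 1"
    define z where "z = a * of_nat n + b"
    define x where "x = Re z - 1"
    have lnn: "0 \<le> ln (real n)" "ln (real n) \<le> real n"
      using n ln_bound [of "real n"] by auto
    have b_n: "\<bar>v\<bar> \<le> \<bar>v\<bar> * real n" for v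
      using mult_left_mono [of 1 "real n" "\<bar>v\<bar>"] n by simp
    have x_eq: "x = Re a * real n + Re b - 1" by (simp add: x_def z_def)
    have "(2 + \<bar>Re b\<bar>) * real n \<le> Re a * real n"
      using assms by (rule mult_right_mono) simp
    hence x: "x \<ge> real n" using b_n [of "Re b"] n by (simp add: x_eq algebra_simps)
    have x_pos: "x > 0" using x n by simp
    have "norm (rGamma z) \<le> rGamma (Re z) * exp ((Im z)\<^sup>2 / Re z)"
      by (rule norm_rGamma_le) (use x_pos x_def in simp)
    also have "\<dots> \<le> exp (- (x * ln x - x)) * exp ((\<bar>Im a\<bar> + \<bar>Im b\<bar>)\<^sup>2 * real n)"
    proof (rule mult_mono)
      have "inverse (Gamma (x + 1)) \<le> inverse (exp (x * ln x - x))"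
        using Gamma_plus1_bounds(1) [OF x_pos] by (intro le_imp_inverse_le) auto
      thus "rGamma (Re z) \<le> exp (- (x * ln x - x))"
        by (simp only: x_def rGamma_inverse_Gamma exp_minus) simp
      have "\<bar>Im z\<bar> \<le> \<bar>Im a * real n\<bar> + \<bar>Im b\<bar>" by (simp add: z_def)
      also have "\<dots> \<le> (\<bar>Im a\<bar> + \<bar>Im b\<bar>) * real n"
        using b_n [of "Im b"] by (simp add: abs_mult algebra_simps)
      finally have "(Im z)\<^sup>2 \<le> ((\<bar>Im a\<bar> + \<bar>Im b\<bar>) * real n)\<^sup>2"
        by (subst power2_abs [symmetric]) (rule power_mono, auto)
      hence "(Im z)\<^sup>2 / Re z \<le> ((\<bar>Im a\<bar> + \<bar>Im b\<bar>) * real n)\<^sup>2 / real n"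
        using x n by (intro frac_le) (auto simp: x_def)
      also have "\<dots> = (\<bar>Im a\<bar> + \<bar>Im b\<bar>)\<^sup>2 * real n"
        using n by (simp add: power2_eq_square)
      finally show "exp ((Im z)\<^sup>2 / Re z) \<le> exp ((\<bar>Im a\<bar> + \<bar>Im b\<bar>)\<^sup>2 * real n)" by simp
    qed auto
    also have "\<dots> = exp (x - x * ln x + (\<bar>Im a\<bar> + \<bar>Im b\<bar>)\<^sup>2 * real n)"
      by (simp flip: exp_add)
    also have "\<dots> \<le> exp (C * real n + (- Re a) * (real n * ln (real n)))"
    proof -
      \<comment> \<open>Here \<open>x \<ge> n\<close> replaces \<open>ln x\<close> by
        \<open>ln n\<close>, leaving the leading term \<open>- Re a * n * ln n\<close>.\<close>
      have "x * ln (real n) \<le> x * ln x"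
        using x n by (intro mult_left_mono) auto
      moreover have "x \<le> (Re a + \<bar>Re b\<bar>) * real n"
        using b_n [of "Re b"] by (simp add: x_eq algebra_simps)
      moreover have "(1 - Re b) * ln (real n) \<le> \<bar>1 - Re b\<bar> * real n"
        using lnn by (intro mult_mono) auto
      ultimately show ?thesis by (simp add: x_eq C_def algebra_simps)
    qed
    finally show "norm (rGamma (a * of_nat n + b)) \<le>
        exp (C * real n + (- Re a) * (real n * ln (real n)))" by (simp add: z_def)
  qed
qed

lemma norm_pochhammer_le_power: "norm (pochhammer (z :: complex) N) \<le> (norm z + real N) ^ N"
proof -
  have "norm (pochhammer z N) = (\<Prod>i<N. norm (z + of_nat i))"
    by (simp add: pochhammer_prod prod_norm atLeast0LessThan)
  also have "\<dots> \<le> (\<Prod>i<N. norm z + real N)"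
  proof (intro prod_mono conjI)
    fix i assume "i \<in> {..<N}"
    thus "norm (z + of_nat i) \<le> norm z + real N"
      using norm_triangle_ineq [of z "of_nat i"] by simp
  qed auto
  finally show ?thesis by simp
qed

text \<open>Shifting the argument by a multiple of \<open>n\<close> moves it far into the right half-plane, where
  \<^term>\<open>rGamma\<close> is controlled by its values on the real axis; this costs a Pochhammer factor
  of exactly compensating growth.\<close>

lemma power_growth_rGamma: "power_growth (- Re a) (\<lambda>n. rGamma (a * of_nat n + b))"
proof -
  \<comment> \<open>The least natural shift bringing \<open>a + L\<close> into the range of
    \<open>power_growth_rGamma_right\<close>.\<close>
  define L where "L = nat \<lceil>2 + \<bar>Re b\<bar> - Re a\<rceil>"
  define K where "K = norm a + norm b + real L + 1"
  have "Re (a + of_nat L) \<ge> 2 + \<bar>Re b\<bar>" unfolding L_def by simp linarith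
  hence 1: "power_growth (- Re (a + of_nat L)) (\<lambda>n. rGamma ((a + of_nat L) * of_nat n + b))"
    by (rule power_growth_rGamma_right)
  have "power_growth (real L) (\<lambda>n. pochhammer (a * of_nat n + b) (L * n))"
  proof (rule power_growthI [where C = "real L * ln K"])
    fix n :: nat assume n: "n \<ge> 1"
    have K: "K > 0" by (simp add: K_def add_nonneg_pos)
    have "norm (a * of_nat n + b) \<le> norm a * real n + norm b"
      using norm_triangle_ineq [of "a * of_nat n" b] by (simp add: norm_mult)
    also have "norm b \<le> norm b * real n" using mult_left_mono [of 1 "real n" "norm b"] n by simp
    finally have "norm (a * of_nat n + b) + real (L * n) \<le> K * real n"
      by (simp add: K_def algebra_simps)
    hence "(norm (a * of_nat n + b) + real (L * n)) ^ (L * n) \<le> (K * real n) ^ (L * n)"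
      by (intro power_mono) auto
    also have "K * real n = exp (ln K + ln (real n))" using K n by (simp add: exp_add)
    also have "\<dots> ^ (L * n) = exp (real (L * n) * (ln K + ln (real n)))"
      by (rule exp_of_nat_mult [symmetric])
    also have "real (L * n) * (ln K + ln (real n)) =
        real L * ln K * real n + real L * (real n * ln (real n))"
      by (simp add: algebra_simps)
    finally show "norm (pochhammer (a * of_nat n + b) (L * n)) \<le>
        exp (real L * ln K * real n + real L * (real n * ln (real n)))"
      using norm_pochhammer_le_power order_trans by blast
  qed
  \<comment> \<open>The exponents \<open>L\<close> and \<open>- (Re a + L)\<close> add up to
    \<open>- Re a\<close>.\<close>
  from power_growth_mult [OF this 1]
  have "power_growth (- Re a)
    (\<lambda>n. pochhammer (a * of_nat n + b) (L * n) * rGamma ((a + of_nat L) * of_nat n + b))" by simp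
  also have "(\<lambda>n. pochhammer (a * of_nat n + b) (L * n) * rGamma ((a + of_nat L) * of_nat n + b)) =
      (\<lambda>n. rGamma (a * of_nat n + b))"
  proof
    fix n
    show "pochhammer (a * of_nat n + b) (L * n) * rGamma ((a + of_nat L) * of_nat n + b) =
        rGamma (a * of_nat n + b)"
      by (subst pochhammer_rGamma [of "a * of_nat n + b" "L * n"]) (simp add: algebra_simps)
  qed
  finally show ?thesis .
qed

section \<open>Termwise integration\<close>

lemma multiindex_bessel_coeff_summable:
  fixes m :: nat
  assumes "\<kappa> > 0" "(\<Sum>j=1..m. Re (\<alpha> j)) > \<kappa> - 1" "Re \<gamma> > 0"
  shows "summable (\<lambda>n. norm (c ^ n * gen_pochhammer \<gamma> (of_real \<kappa> * of_nat n)
          * (\<Prod>j=1..m. rGamma (\<alpha> j * of_nat n + \<beta> j + (b + 1) / 2)) * (y ^ n / fact n)))"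
proof (rule power_growth_summable)
  \<comment> \<open>Powers and constants contribute 0, the rising factorial \<open>\<kappa>\<close>,
    each lower factor \<open>- Re (\<alpha> j)\<close>. Writing \<open>1 / n!\<close> as
    \<open>rGamma (n + 1)\<close> makes it another lower factor, with exponent -1.\<close>
  have "power_growth (0 + (\<kappa> + 0) + (\<Sum>j=1..m. - Re (\<alpha> j)) + (0 + (- Re 1)))
    (\<lambda>n. c ^ n * (Gamma (\<gamma> + of_real \<kappa> * of_nat n) * inverse (Gamma \<gamma>))
          * (\<Prod>j=1..m. rGamma (\<alpha> j * of_nat n + (\<beta> j + (b + 1) / 2))) * (y ^ n * rGamma (1 * of_nat n + 1)))"
    using assms(1,3)
    by (intro power_growth_mult power_growth_const_power power_growth_const power_growth_Gamma
        power_growth_prod power_growth_rGamma finite_atLeastAtMost) auto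
  moreover have "Gamma z * inverse (Gamma \<gamma>) = gen_pochhammer \<gamma> (z - \<gamma>)" for z
    by (simp add: gen_pochhammer_def divide_inverse)
  moreover have "u * rGamma (1 * of_nat n + 1) = u / (fact n :: complex)" for u n
    using Gamma_fact [of n, where ?'a = complex]
    by (simp add: rGamma_inverse_Gamma add.commute divide_inverse)
  ultimately show "power_growth (\<kappa> - (\<Sum>j=1..m. Re (\<alpha> j)) - 1)
    (\<lambda>n. c ^ n * gen_pochhammer \<gamma> (of_real \<kappa> * of_nat n)
          * (\<Prod>j=1..m. rGamma (\<alpha> j * of_nat n + \<beta> j + (b + 1) / 2)) * (y ^ n / fact n))"
    by (simp add: sum_negf add.assoc)
qed (use assms in simp)

text \<open>Dominated convergence for the partial sums, with majorant \<open>norm (w x)\<close>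
  times the sum of \<open>norm (t n)\<close>. Summability of the integrated series is recorded too,
  since a constant is factored out of it later.\<close>

lemma has_integral_powser:
  fixes w :: "real \<Rightarrow> complex" and p :: "real \<Rightarrow> real" and t :: "nat \<Rightarrow> complex"
  assumes w: "w absolutely_integrable_on S"
    and p: "\<And>x. x \<in> S \<Longrightarrow> \<bar>p x\<bar> \<le> 1"
    and I: "\<And>n. ((\<lambda>x. w x * of_real (p x) ^ n) has_integral v n) S"
    and t: "summable (\<lambda>n. norm (t n))"
  shows "summable (\<lambda>n. t n * v n)"
    and "((\<lambda>x. w x * (\<Sum>n. t n * of_real (p x) ^ n)) has_integral (\<Sum>n. t n * v n)) S"
proof -
  define f where "f = (\<lambda>k x. \<Sum>n<k. t n * (w x * of_real (p x) ^ n))"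
  define g where "g = (\<lambda>x. w x * (\<Sum>n. t n * of_real (p x) ^ n))"
  have f: "(f k has_integral (\<Sum>n<k. t n * v n)) S" for k
    unfolding f_def by (intro has_integral_sum has_integral_mult_right I) auto
  have le: "norm (t n * of_real (p x) ^ n) \<le> norm (t n)" if "x \<in> S" for n x
    unfolding norm_mult norm_power norm_of_real
    using p [OF that] by (intro mult_left_le power_le_one) auto
  have summ: "summable (\<lambda>n. norm (t n * of_real (p x) ^ n))" if "x \<in> S" for x
    by (rule summable_comparison_test' [OF t]) (use le [OF that] in simp)
  have f_eq: "f k x = w x * (\<Sum>n<k. t n * of_real (p x) ^ n)" for k x
    by (simp add: f_def sum_distrib_left mult_ac)
  have dom: "norm (f k x) \<le> norm (w x) * (\<Sum>n. norm (t n))" if "x \<in> S" for k x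
  proof -
    have "norm (\<Sum>n<k. t n * of_real (p x) ^ n) \<le> (\<Sum>n<k. norm (t n))"
      by (rule sum_norm_le) (use le [OF that] in auto)
    also have "\<dots> \<le> (\<Sum>n. norm (t n))"
      by (rule sum_le_suminf [OF t]) auto
    finally show ?thesis unfolding f_eq norm_mult by (rule mult_left_mono) simp
  qed
  have conv: "(\<lambda>k. f k x) \<longlonglongrightarrow> g x" if "x \<in> S" for x
    unfolding f_eq g_def
    by (rule tendsto_mult_left [OF summable_LIMSEQ [OF summable_norm_cancel [OF summ [OF that]]]])
  have h: "(\<lambda>x. norm (w x) * (\<Sum>n. norm (t n))) integrable_on S"
    using w by (intro integrable_on_mult_left) (simp add: absolutely_integrable_on_def)
  have int: "f k integrable_on S" for k by (rule has_integral_integrable [OF f])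
  note dc = dominated_convergence [OF int h dom conv]
  have "(\<lambda>k. integral S (f k)) = (\<lambda>k. \<Sum>n<k. t n * v n)"
    by (intro ext integral_unique f)
  hence sums: "(\<lambda>n. t n * v n) sums integral S g"
    using dc(2) by (simp add: sums_def)
  thus "summable (\<lambda>n. t n * v n)" by (rule sums_summable)
  show "((\<lambda>x. w x * (\<Sum>n. t n * of_real (p x) ^ n)) has_integral (\<Sum>n. t n * v n)) S"
    using dc(1) sums_unique [OF sums] unfolding g_def by (simp only: has_integral_iff)
qed

text \<open>Replacing \<open>a\<close> by \<open>a + n\<close> multiplies the weight by
  \<open>x^n * (1 - x / 3)^(2 * n)\<close>, and the constant by
  \<open>(2 / 3)^(2 * n)\<close>.\<close>

lemma Lavoie_Trottier_power:
  assumes a: "Re a > 0" and b: "Re b > 0"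
  shows "((\<lambda>x::real. of_real x powr (a - 1) * of_real (1 - x) powr (2 * b - 1)
              * of_real (1 - x / 3) powr (2 * a - 1) * of_real (1 - x / 4) powr (b - 1)
              * of_real (x * (1 - x / 3) ^ 2) ^ n) has_integral
          ((2 / 3) powr (2 * a) * (4 / 9) ^ n * Beta (a + of_nat n) b)) {0..1}"
proof -
  have eq: "(2 / 3) powr (2 * (a + of_nat n)) = (2 / 3 :: complex) powr (2 * a) * (4 / 9) ^ n"
  proof -
    have "(2 / 3) powr (2 * (a + of_nat n)) = (2 / 3 :: complex) powr (2 * a + of_nat (2 * n))"
      by (simp add: algebra_simps)
    also have "\<dots> = (2 / 3) powr (2 * a) * (2 / 3) ^ (2 * n)"
      by (subst powr_add, subst powr_nat) simp
    finally show ?thesis by (simp add: power_mult power2_eq_square)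
  qed
  have "((\<lambda>x::real. of_real x powr (a + of_nat n - 1) * of_real (1 - x) powr (2 * b - 1)
              * of_real (1 - x / 3) powr (2 * (a + of_nat n) - 1) * of_real (1 - x / 4) powr (b - 1))
        has_integral ((2 / 3) powr (2 * (a + of_nat n)) * Beta (a + of_nat n) b)) {0..1}"
    by (rule Lavoie_Trottier) (use assms in auto)
  thus ?thesis unfolding eq
  proof (rule has_integral_eq [rotated])
    fix x :: real assume x: "x \<in> {0..1}"
    have 1: "complex_of_real x powr (a + of_nat n - 1) = of_real x powr (a - 1) * of_real x ^ n"
    \<comment> \<open>At 0 both sides are 0, because \<open>0 powr z = 0\<close>.\<close>
    proof (cases "x = 0")
      case False
      have "complex_of_real x powr (a - 1 + of_nat n) = of_real x powr (a - 1) * of_real x ^ n"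
        using False by (subst powr_add, subst powr_nat) auto
      thus ?thesis by (simp add: algebra_simps)
    qed auto
    have 2: "complex_of_real (1 - x / 3) powr (2 * (a + of_nat n) - 1) =
        of_real (1 - x / 3) powr (2 * a - 1) * of_real ((1 - x / 3)\<^sup>2) ^ n"
    proof -
      have nz: "complex_of_real (1 - x / 3) \<noteq> 0"
        unfolding of_real_eq_0_iff using x by auto
      have "complex_of_real (1 - x / 3) powr (2 * (a + of_nat n) - 1) =
          of_real (1 - x / 3) powr (2 * a - 1 + of_nat (2 * n))"
        by (simp add: algebra_simps)
      also have "\<dots> = of_real (1 - x / 3) powr (2 * a - 1) * of_real (1 - x / 3) ^ (2 * n)"
        using nz by (subst powr_add, subst powr_nat) auto
      finally show ?thesis by (simp only: power_mult of_real_power)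
    qed
    show "of_real x powr (a + of_nat n - 1) * of_real (1 - x) powr (2 * b - 1)
              * of_real (1 - x / 3) powr (2 * (a + of_nat n) - 1) * of_real (1 - x / 4) powr (b - 1) =
          of_real x powr (a - 1) * of_real (1 - x) powr (2 * b - 1)
              * of_real (1 - x / 3) powr (2 * a - 1) * of_real (1 - x / 4) powr (b - 1)
              * of_real (x * (1 - x / 3) ^ 2) ^ n"
      unfolding 1 2 by (simp only: of_real_mult power_mult_distrib mult_ac)
  qed
qed

theorem theorem8:
  fixes m :: nat
    and \<alpha> \<beta> :: "nat \<Rightarrow> complex"
    and \<gamma> b c \<xi> \<sigma> y :: complex
    and \<kappa> :: real
  assumes "\<kappa> > 0"
    and "(\<Sum>j=1..m. Re (\<alpha> j)) > max 0 (\<kappa> - 1)"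
    and "\<And>j. j \<in> {1..m} \<Longrightarrow> Re (\<beta> j) > 0"
    and "Re \<gamma> > 0"
    and "Re (\<xi> + \<sigma>) > 0"
    and "Re \<xi> > 0"
  shows "((\<lambda>x::real.
            of_real x powr (\<xi> - 1)
            * of_real (1 - x) powr (2 * (\<xi> + \<sigma>) - 1)
            * of_real (1 - x / 3) powr (2 * \<xi> - 1)
            * of_real (1 - x / 4) powr ((\<xi> + \<sigma>) - 1)
            * multiindex_bessel m \<alpha> \<beta> \<kappa> b \<gamma> c (y * of_real x * (1 - of_real x / 3) ^ 2))
         has_integral
           (Gamma (\<xi> + \<sigma>) / Gamma \<gamma> * (2 / 3) powr (2 * \<xi>)
            * fox_wright [(\<gamma>, of_real \<kappa>), (\<xi>, 1)]
                (map (\<lambda>j. (\<beta> j + (b + 1) / 2, \<alpha> j)) [1..<m+1] @ [(2 * \<xi> + \<sigma>, 1)])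
                (4 * c * y / 9))) {0..1}"
proof -
  define w where "w = (\<lambda>x::real. of_real x powr (\<xi> - 1)
            * of_real (1 - x) powr (2 * (\<xi> + \<sigma>) - 1)
            * of_real (1 - x / 3) powr (2 * \<xi> - 1)
            * of_real (1 - x / 4) powr ((\<xi> + \<sigma>) - 1))"
  define p where "p = (\<lambda>x::real. x * (1 - x / 3) ^ 2)"
  \<comment> \<open>The argument of the Bessel function is \<open>y * p x\<close>; the power of
    \<open>y\<close> goes into the coefficient so that the variable part stays bounded by 1.\<close>
  define t where "t = (\<lambda>n. c ^ n * gen_pochhammer \<gamma> (of_real \<kappa> * of_nat n)
          * (\<Prod>j=1..m. rGamma (\<alpha> j * of_nat n + \<beta> j + (b + 1) / 2)) * (y ^ n / fact n))"
  define v where "v = (\<lambda>n. (2 / 3) powr (2 * \<xi>) * (4 / 9) ^ n * Beta (\<xi> + of_nat n) (\<xi> + \<sigma>))"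
  define K where "K = Gamma (\<xi> + \<sigma>) / Gamma \<gamma> * (2 / 3) powr (2 * \<xi>)"
  define q where "q = (\<lambda>n. (\<Prod>(a, A)\<leftarrow>[(\<gamma>, of_real \<kappa>), (\<xi>, 1)]. Gamma (a + A * of_nat n))
          * (\<Prod>(b, B)\<leftarrow>map (\<lambda>j. (\<beta> j + (b + 1) / 2, \<alpha> j)) [1..<m+1] @ [(2 * \<xi> + \<sigma>, 1)].
               rGamma (b + B * of_nat n))
          * ((4 * c * y / 9) ^ n / fact n))"
  have w_abs: "w absolutely_integrable_on {0..1}"
    unfolding w_def by (rule Lavoie_Trottier) (use assms in auto)
  have p01: "\<bar>p x\<bar> \<le> 1" if "x \<in> {0..1}" for x
  proof -
    have "0 \<le> (1 - x / 3)\<^sup>2" "(1 - x / 3)\<^sup>2 \<le> 1"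
      using that by (auto intro!: power_le_one)
    hence "0 \<le> p x" "p x \<le> 1 * 1"
      unfolding p_def using that by (intro mult_nonneg_nonneg mult_mono; simp)+
    thus ?thesis by simp
  qed
  have I: "((\<lambda>x. w x * of_real (p x) ^ n) has_integral v n) {0..1}" for n
    unfolding w_def p_def v_def by (rule Lavoie_Trottier_power) (use assms in auto)
  have t_summ: "summable (\<lambda>n. norm (t n))"
    unfolding t_def by (rule multiindex_bessel_coeff_summable) (use assms in auto)
  note series = has_integral_powser [OF w_abs p01 I t_summ]
  have bessel: "multiindex_bessel m \<alpha> \<beta> \<kappa> b \<gamma> c (y * of_real x * (1 - of_real x / 3) ^ 2) =
      (\<Sum>n. t n * of_real (p x) ^ n)" for x
    unfolding multiindex_bessel_def
  proof (intro suminf_cong)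
    fix n
    have eq: "y * of_real x * (1 - of_real x / 3) ^ 2 = y * complex_of_real (p x)"
      by (simp add: p_def)
    show "c ^ n * gen_pochhammer \<gamma> (of_real \<kappa> * of_nat n)
          * (\<Prod>j=1..m. rGamma (\<alpha> j * of_nat n + \<beta> j + (b + 1) / 2))
          * ((y * of_real x * (1 - of_real x / 3) ^ 2) ^ n / fact n) = t n * of_real (p x) ^ n"
      unfolding eq t_def by (simp only: power_mult_distrib times_divide_eq_left times_divide_eq_right mult_ac)
  qed
  have lower: "(\<Prod>(b, B)\<leftarrow>map (\<lambda>j. (\<beta> j + (b + 1) / 2, \<alpha> j)) [1..<m+1]. rGamma (b + B * of_nat n)) =
      (\<Prod>j=1..m. rGamma (\<alpha> j * of_nat n + \<beta> j + (b + 1) / 2))" for n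
  proof -
    have "(\<Prod>(b, B)\<leftarrow>map (\<lambda>j. (\<beta> j + (b + 1) / 2, \<alpha> j)) [1..<m+1]. rGamma (b + B * of_nat n)) =
        (\<Prod>j\<leftarrow>[1..<m+1]. rGamma (\<alpha> j * of_nat n + \<beta> j + (b + 1) / 2))"
      by (simp add: o_def add_ac)
    also have "\<dots> = (\<Prod>j\<in>set [1..<m+1]. rGamma (\<alpha> j * of_nat n + \<beta> j + (b + 1) / 2))"
      by (rule prod.distinct_set_conv_list [symmetric]) simp
    also have "set [1..<m+1] = {1..m}" by auto
    finally show ?thesis .
  qed
  \<comment> \<open>The Beta value yields the pairs \<open>(\<xi>, 1)\<close> above and
    \<open>(2 * \<xi> + \<sigma>, 1)\<close> below; \<open>(4 / 9) ^ n\<close> joins the argument,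
    and the factors free of \<open>n\<close> form \<open>K\<close>.\<close>
  have tv: "t n * v n = K * q n" for n
  proof -
    have "q n = Gamma (\<gamma> + of_real \<kappa> * of_nat n) * Gamma (\<xi> + of_nat n)
        * ((\<Prod>j=1..m. rGamma (\<alpha> j * of_nat n + \<beta> j + (b + 1) / 2)) * rGamma (2 * \<xi> + \<sigma> + of_nat n))
        * ((4 / 9) ^ n * c ^ n * y ^ n / fact n)"
      unfolding q_def map_append prod_list.append lower
      by (simp add: power_mult_distrib power_divide)
    moreover have "\<xi> + of_nat n + (\<xi> + \<sigma>) = 2 * \<xi> + \<sigma> + of_nat n" by simp
    hence "Beta (\<xi> + of_nat n) (\<xi> + \<sigma>) =
        Gamma (\<xi> + of_nat n) * Gamma (\<xi> + \<sigma>) * rGamma (2 * \<xi> + \<sigma> + of_nat n)"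
      by (simp only: Beta_altdef)
    ultimately show ?thesis
      by (simp add: t_def v_def K_def gen_pochhammer_def)
  qed
  have nonpole: "Gamma z \<noteq> 0" if "Re z > 0" for z :: complex
    using that by (auto simp: Gamma_eq_zero_iff elim!: nonpos_Ints_cases)
  \<comment> \<open>Summability is known for \<open>K * q n\<close>; it passes to \<open>q\<close>
    only for nonzero \<open>K\<close>.\<close>
  have "K \<noteq> 0" unfolding K_def using assms by (auto simp: nonpole)
  have "summable q" using series(1) \<open>K \<noteq> 0\<close> by (simp add: tv summable_cmult_iff)
  hence "(\<Sum>n. t n * v n) = K * fox_wright [(\<gamma>, of_real \<kappa>), (\<xi>, 1)]
                (map (\<lambda>j. (\<beta> j + (b + 1) / 2, \<alpha> j)) [1..<m+1] @ [(2 * \<xi> + \<sigma>, 1)])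
                (4 * c * y / 9)"
    unfolding tv fox_wright_def q_def [symmetric] by (intro suminf_mult)
  with series(2) show ?thesis
    unfolding bessel w_def K_def by simp
qed

end
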